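(* Let $n\ge1$ and let $\alpha(t)=re^{\lambda t}$, where $r>0$ and $\lambda\in\mathbb{R}$ are constants. Then (i) $\alpha\in\Psi$ if and only if $-1\le\lambda\le1$; (ii) $dS_{n+1}(f_\alpha)$ is a timelike hypersurface if and only if $-1<\lambda<1$; (iii) $dS_{n+1}(f_\alpha)$ is a null hypersurface if and only if $\lambda=1$ or $\lambda=-1$. (In (ii) and (iii), the left-hand conditions are understood to include that $\alpha\in\Psi$, so that $f_\alpha$ is defined.)
   Context: $\mathbb{R}^{n+2}_1$ is $\mathbb{R}^{n+2}$ with metric $\eta=-dx^0\otimes dx^0+dx^1\otimes dx^1+\cdots+dx^{n+1}\otimes dx^{n+1}$. For a smooth function $f:(a,b)\to\mathbb{R}$ on an open interval (possibly unbounded), $dS_{n+1}(f)$ is the hypersurface $\{x\in\mathbb{R}^{n+2}_1 : x^0\in(a,b),\ -(x^0)^2+(x^1)^2+\cdots+(x^{n+1})^2=f(x^0)^2\}$ with the metric induced from $\eta$. $\Psi$ is the set of smooth functions $\alpha:\mathbb{R}\to\mathbb{R}$ with $\alpha(t)>0$ for all $t$ and such that $h(t):=\alpha(t)\sinh t$ has nonzero derivative for all $t$. For $\alpha\in\Psi$ (only), $f_\alpha:=\alpha\circ h^{-1}$ on the open interval $h(\mathbb{R})$. A vector $v$ is timelike if $\eta(v,v)<0$, null if $\eta(v,v)=0$ and $v\ne0$, spacelike if $\eta(v,v)>0$. A hypersurface $\Sigma$ is called timelike (resp. null, spacelike) if for every $p\in\Sigma$ the normal to $T_p\Sigma$ is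 spacelike (resp. null, timelike); equivalently, the induced metric is Lorentzian (resp. degenerate, Riemannian) at every point. *)

theory Defs
  imports "HOL-Analysis.Analysis"
begin

text \<open>
  Smoothness on an open set. In finite dimension, being k times continuously differentiable
  amounts to all iterated directional derivatives up to order k existing and being continuous,
  which avoids iterating over spaces of linear maps.
\<close>

primrec Ck_on :: "nat \<Rightarrow> 'a::euclidean_space set \<Rightarrow> ('a \<Rightarrow> 'b::real_normed_vector) \<Rightarrow> bool" where
  "Ck_on 0 U f \<longleftrightarrow> continuous_on U f"
| "Ck_on (Suc k) U f \<longleftrightarrow> (\<forall>x\<in>U. f differentiable (at x)) \<and>
     (\<forall>v. Ck_on k U (\<lambda>x. frechet_derivative f (at x) v))"

definition smooth_on :: "'a::euclidean_space set \<Rightarrow> ('a \<Rightarrow> 'b::real_normed_vector) \<Rightarrow> bool" where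
  "smooth_on U f \<longleftrightarrow> (\<forall>k. Ck_on k U f)"

text \<open>
  The Lorentz-Minkowski space of dimension \<open>CARD('m) + 1\<close>: the first component is the
  time coordinate \<open>x\<^sup>0\<close>, the second one collects the spatial coordinates.
\<close>

type_synonym 'm minkowski = "real \<times> (real ^ 'm)"

definition \<eta> :: "'m::finite minkowski \<Rightarrow> 'm minkowski \<Rightarrow> real" where
  "\<eta> x y = - (fst x * fst y) + (\<Sum>i\<in>UNIV. snd x $ i * snd y $ i)"

definition timelike :: "'m::finite minkowski \<Rightarrow> bool" where
  "timelike v \<longleftrightarrow> \<eta> v v < 0"

definition null :: "'m::finite minkowski \<Rightarrow> bool" where
  "null v \<longleftrightarrow> \<eta> v v = 0 \<and> v \<noteq> 0"

definition spacelike :: "'m::finite minkowski \<Rightarrow> bool" where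
  "spacelike v \<longleftrightarrow> \<eta> v v > 0"

text \<open>Smooth embedded submanifolds of codimension one, as sets that are locally regular level sets.\<close>

definition hypersurface :: "'a::euclidean_space set \<Rightarrow> bool" where
  "hypersurface S \<longleftrightarrow>
     (\<forall>p\<in>S. \<exists>U (g :: 'a \<Rightarrow> real). open U \<and> p \<in> U \<and> smooth_on U g \<and>
        S \<inter> U = {x \<in> U. g x = 0} \<and>
        (\<forall>x\<in>S \<inter> U. \<exists>v. frechet_derivative g (at x) v \<noteq> 0))"

definition tangent_space :: "'a::euclidean_space set \<Rightarrow> 'a \<Rightarrow> 'a set" where
  "tangent_space S p =
     {v. \<exists>(\<gamma> :: real \<Rightarrow> 'a) e. e > 0 \<and> smooth_on {-e<..<e} \<gamma> \<and> \<gamma> ` {-e<..<e} \<subseteq> S \<and>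
           \<gamma> 0 = p \<and> (\<gamma> has_vector_derivative v) (at 0)}"

definition normal_space :: "'m::finite minkowski set \<Rightarrow> 'm minkowski \<Rightarrow> 'm minkowski set" where
  "normal_space S p = {v. \<forall>w\<in>tangent_space S p. \<eta> v w = 0}"

text \<open>
  The normal space of a hypersurface is a line, so ``the normal'' is any of its nonzero elements.
  The causal character of a hypersurface is dual to that of its normal.
\<close>

definition timelike_hypersurface :: "'m::finite minkowski set \<Rightarrow> bool" where
  "timelike_hypersurface S \<longleftrightarrow>
     hypersurface S \<and> (\<forall>p\<in>S. \<forall>v\<in>normal_space S p. v \<noteq> 0 \<longrightarrow> spacelike v)"

definition null_hypersurface :: "'m::finite minkowski set \<Rightarrow> bool" where
  "null_hypersurface S \<longleftrightarrow>
     hypersurface S \<and> (\<forall>p\<in>S. \<forall>v\<in>normal_space S p. v \<noteq> 0 \<longrightarrow> null v)"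

text \<open>
  The set \<open>dS I f\<close> is \<open>dS\<^bsub>n+1\<^esub>(f)\<close> for \<open>f\<close> defined on the open interval \<open>I\<close>, where \<open>n + 1 = CARD('m)\<close>;
  values of \<open>f\<close> outside \<open>I\<close> are irrelevant.
\<close>

definition dS :: "real set \<Rightarrow> (real \<Rightarrow> real) \<Rightarrow> 'm::finite minkowski set" where
  "dS I f = {x. fst x \<in> I \<and> - (fst x)\<^sup>2 + (\<Sum>i\<in>UNIV. (snd x $ i)\<^sup>2) = (f (fst x))\<^sup>2}"

definition h :: "(real \<Rightarrow> real) \<Rightarrow> real \<Rightarrow> real" where
  "h \<alpha> t = \<alpha> t * sinh t"

definition \<Psi> :: "(real \<Rightarrow> real) set" where
  "\<Psi> = {\<alpha>. smooth_on UNIV \<alpha> \<and> (\<forall>t. \<alpha> t > 0) \<and> (\<forall>t. deriv (h \<alpha>) t \<noteq> 0)}"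

text \<open>Meaningful only for \<open>\<alpha> \<in> \<Psi>\<close>, where \<open>h \<alpha>\<close> is injective, and only on \<open>range (h \<alpha>)\<close>.\<close>

definition f_of :: "(real \<Rightarrow> real) \<Rightarrow> real \<Rightarrow> real" where
  "f_of \<alpha> = \<alpha> \<circ> inv (h \<alpha>)"

end

theory Submission
  imports Defs
begin

text \<open>
  For \<open>\<alpha> \<in> \<Psi>\<close> write \<open>h = \<alpha> sinh\<close> and \<open>k = \<alpha> cosh\<close>. Substituting \<open>x\<^sup>0 = h t\<close> in the equation of
  \<open>dS\<^bsub>n+1\<^esub>(f\<^bsub>\<alpha>\<^esub>)\<close> and using \<open>cosh\<^sup>2 - sinh\<^sup>2 = 1\<close> shows that the set is the hypersurface of
  revolution of the curve \<open>t \<mapsto> (h t, k t)\<close>: it consists of the points \<open>(h t, y)\<close> with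
  \<open>\<bar>y\<bar> = k t\<close> (\<open>mem_dS_iff\<close>). It is a regular level set because \<open>h\<close>, having nowhere vanishing
  derivative, has a smooth inverse, so that \<open>f\<^bsub>\<alpha>\<^esub> = \<alpha> \<circ> h\<^sup>-\<^sup>1\<close> is smooth (\<open>hypersurface_dS\<close>).

  As for every hypersurface of revolution, the normal line at \<open>(h t, y)\<close> lies in the plane of the
  meridian; it is spanned by \<open>N = (k k', h' y)\<close> (\<open>normal_space_dS\<close>). Here \<open>N\<close> is normal because the
  differential of the defining equation is a multiple of \<open>\<eta> N\<close>, and nothing else is normal because
  the tangent vectors of the rotations and of the meridian already cut the normal space down to a
  line. Now
    \<open>\<eta>(N, N) = k\<^sup>2 (h'\<^sup>2 - k'\<^sup>2) = k\<^sup>2 (\<alpha>\<^sup>2 - \<alpha>'\<^sup>2)\<close>,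
  again by \<open>cosh\<^sup>2 - sinh\<^sup>2 = 1\<close>. Hence for every \<open>\<alpha> \<in> \<Psi>\<close> the hypersurface is timelike iff
  \<open>\<alpha>'\<^sup>2 < \<alpha>\<^sup>2\<close> everywhere and null iff \<open>\<alpha>'\<^sup>2 = \<alpha>\<^sup>2\<close> everywhere (\<open>timelike_dS_iff\<close>, \<open>null_dS_iff\<close>).

  For \<open>\<alpha> t = r exp (\<lambda> t)\<close> we have \<open>\<alpha>' = \<lambda> \<alpha>\<close>, so these conditions are \<open>\<lambda>\<^sup>2 < 1\<close> and \<open>\<lambda>\<^sup>2 = 1\<close>.
  Finally \<open>h' t\<close> is a positive multiple of \<open>\<lambda> sinh t + cosh t\<close>, which has a zero exactly when
  \<open>\<bar>\<lambda>\<bar> > 1\<close>; this decides membership in \<open>\<Psi>\<close>.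
\<close>

section \<open>Calculus of smooth maps\<close>

text \<open>
  Openness of \<open>U\<close> matters: the derivatives in \<open>Ck_on\<close> are taken in the whole space, so values on
  \<open>U\<close> determine them only at interior points.
\<close>

lemma Ck_on_cong:
  assumes "open U" and "\<And>x. x \<in> U \<Longrightarrow> f x = g x" and "Ck_on k U f"
  shows "Ck_on k U g"
  using assms(2,3)
proof (induction k arbitrary: f g)
  case 0
  then show ?case
    using continuous_on_cong by fastforce
next
  case (Suc k)
  have D: "(g has_derivative frechet_derivative f (at x)) (at x)" if "x \<in> U" for x
  proof (rule has_derivative_transform_within_open[OF _ assms(1) that])
    show "(f has_derivative frechet_derivative f (at x)) (at x)"
      using Suc.prems(2) that frechet_derivative_works by auto
  qed (use Suc.prems(1) in auto)
  have "Ck_on k U (\<lambda>x. frechet_derivative g (at x) v)" for v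
  proof (rule Suc.IH)
    show "Ck_on k U (\<lambda>x. frechet_derivative f (at x) v)"
      using Suc.prems(2) by simp
  qed (simp add: frechet_derivative_at[OF D])
  then show ?case
    using D by (auto intro: differentiableI)
qed

text \<open>
  The introduction rule that lets any explicit derivative replace \<open>frechet_derivative\<close>. It
  carries the step of the inductions on \<open>k\<close> below.
\<close>

lemma Ck_on_Suc_if_has_derivative:
  assumes "open U"
    and "\<And>x. x \<in> U \<Longrightarrow> (f has_derivative D x) (at x)"
    and "\<And>v. Ck_on k U (\<lambda>x. D x v)"
  shows "Ck_on (Suc k) U f"
proof -
  have "Ck_on k U (\<lambda>x. frechet_derivative f (at x) v)" for v
    by (rule Ck_on_cong[OF assms(1) _ assms(3)[of v]]) (simp add: frechet_derivative_at[OF assms(2)])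
  then show ?thesis
    using assms(2) by (auto intro: differentiableI)
qed

lemma Ck_on_has_derivative:
  assumes "Ck_on (Suc k) U f" "x \<in> U"
  shows "(f has_derivative frechet_derivative f (at x)) (at x)"
  using assms frechet_derivative_works by auto

lemma Ck_on_frechet_derivative:
  "Ck_on (Suc k) U f \<Longrightarrow> Ck_on k U (\<lambda>x. frechet_derivative f (at x) v)"
  by simp

lemma Ck_on_lower: "Ck_on (Suc k) U f \<Longrightarrow> Ck_on k U f"
proof (induction k arbitrary: f)
  case 0
  then show ?case
    by (auto intro!: continuous_at_imp_continuous_on differentiable_imp_continuous_within)
next
  case (Suc k)
  then show ?case
    unfolding Ck_on.simps(2)[of _ U f] by blast
qed

lemma smooth_on_Ck: "smooth_on U f \<Longrightarrow> Ck_on k U f"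
  by (simp add: smooth_on_def)

lemma Ck_on_const: "Ck_on k U (\<lambda>x. c)"
  by (induction k arbitrary: c) auto

lemma Ck_on_add:
  assumes "open U" "Ck_on k U f" "Ck_on k U g"
  shows "Ck_on k U (\<lambda>x. f x + g x)"
  using assms(2,3)
proof (induction k arbitrary: f g)
  case 0
  then show ?case
    by (auto intro: continuous_intros)
next
  case (Suc k)
  show ?case
    by (rule Ck_on_Suc_if_has_derivative[OF assms(1)
          has_derivative_add[OF Ck_on_has_derivative[OF Suc.prems(1)] Ck_on_has_derivative[OF Suc.prems(2)]]])
      (assumption+, intro Suc.IH Ck_on_frechet_derivative Suc.prems)
qed

lemma (in bounded_bilinear) Ck_on_bilinear:
  assumes "open U" "Ck_on k U f" "Ck_on k U g"
  shows "Ck_on k U (\<lambda>x. prod (f x) (g x))"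
  using assms(2,3)
proof (induction k arbitrary: f g)
  case 0
  then show ?case
    by (simp add: continuous_on)
next
  case (Suc k)
  note lower = Suc.prems[THEN Ck_on_lower]
  show ?case
    by (rule Ck_on_Suc_if_has_derivative[OF assms(1)
          FDERIV[OF Ck_on_has_derivative[OF Suc.prems(1)] Ck_on_has_derivative[OF Suc.prems(2)]]])
      (assumption+, intro Ck_on_add[OF assms(1)] Suc.IH lower Ck_on_frechet_derivative Suc.prems)
qed

lemmas Ck_on_scaleR = bounded_bilinear.Ck_on_bilinear[OF bounded_bilinear_scaleR]
  and Ck_on_mult = bounded_bilinear.Ck_on_bilinear[OF bounded_bilinear_mult]
  and Ck_on_inner = bounded_bilinear.Ck_on_bilinear[OF bounded_bilinear_inner]

lemma Ck_on_bounded_linear: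
  assumes "open U" "bounded_linear L"
  shows "Ck_on k U L"
proof (cases k)
  case 0
  then show ?thesis
    using assms linear_continuous_on by auto
next
  case (Suc j)
  show ?thesis unfolding Suc
    by (rule Ck_on_Suc_if_has_derivative[OF assms(1) bounded_linear_imp_has_derivative[OF assms(2)]])
      (rule Ck_on_const)
qed

text \<open>
  An inner function with real values suffices for the present purposes and keeps the chain rule a
  single product, \<open>D(f \<circ> g) v = Dg v \<cdot> f'(g)\<close>, to which the induction hypothesis for \<open>f'\<close> and \<open>g\<close> applies.
\<close>

lemma Ck_on_compose_real:
  fixes g :: "'a::euclidean_space \<Rightarrow> real"
  assumes "open U" "open V" "g ` U \<subseteq> V" "Ck_on k V f" "Ck_on k U g"
  shows "Ck_on k U (\<lambda>x. f (g x))"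
  using assms(4,5)
proof (induction k arbitrary: f)
  case 0
  then show ?case
    using assms(3) continuous_on_compose2[of V f U g] by simp
next
  case (Suc k)
  have D: "((\<lambda>x. f (g x)) has_derivative
      (\<lambda>v. frechet_derivative g (at x) v *\<^sub>R frechet_derivative f (at (g x)) 1)) (at x)"
    if "x \<in> U" for x
  proof -
    have f: "(f has_derivative frechet_derivative f (at (g x))) (at (g x))"
      by (rule Ck_on_has_derivative[OF Suc.prems(1)]) (use that assms(3) in auto)
    have "s *\<^sub>R frechet_derivative f (at (g x)) 1 = frechet_derivative f (at (g x)) s" for s
      using linear_scale[OF has_derivative_linear[OF f], of s 1] by simp
    then show ?thesis
      using has_derivative_compose[OF Ck_on_has_derivative[OF Suc.prems(2) that] f] by (simp only:)
  qed
  show ?case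
  proof (rule Ck_on_Suc_if_has_derivative[OF assms(1) D])
    fix v
    have "Ck_on k U (\<lambda>x. frechet_derivative f (at (g x)) 1)"
      by (rule Suc.IH[of "\<lambda>y. frechet_derivative f (at y) 1"])
        (rule Ck_on_frechet_derivative[OF Suc.prems(1)] Ck_on_lower[OF Suc.prems(2)])+
    then show "Ck_on k U (\<lambda>x. frechet_derivative g (at x) v *\<^sub>R frechet_derivative f (at (g x)) 1)"
      by (rule Ck_on_scaleR[OF assms(1) Ck_on_frechet_derivative[OF Suc.prems(2)]])
  qed
qed

lemma Ck_on_Suc_real:
  fixes f :: "real \<Rightarrow> real"
  assumes "open U" "\<And>x. x \<in> U \<Longrightarrow> (f has_real_derivative f' x) (at x)" "Ck_on k U f'"
  shows "Ck_on (Suc k) U f"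
  by (rule Ck_on_Suc_if_has_derivative[OF assms(1) assms(2)[unfolded has_field_derivative_def]])
    (assumption, intro Ck_on_mult[OF assms(1)] assms(3) Ck_on_const)

lemma Ck_on_inverse_real: "Ck_on k (- {0}) (inverse :: real \<Rightarrow> real)"
proof (induction k)
  case 0
  then show ?case
    by (auto intro: continuous_intros)
next
  case (Suc k)
  have op: "open (- {0 :: real})"
    by auto
  show ?case
  proof (rule Ck_on_Suc_real[OF op])
    show "(inverse has_real_derivative (- 1) * (inverse x * inverse x)) (at x)" if "x \<in> - {0}" for x :: real
      using that by (auto intro!: derivative_eq_intros)
    show "Ck_on k (- {0}) (\<lambda>x::real. (- 1) * (inverse x * inverse x))"
      by (intro Ck_on_mult op Ck_on_const Suc.IH)
  qed
qed

text \<open>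
  If \<open>f' = g\<close> and \<open>g' = c f\<close>, differentiability of the pair bootstraps itself. This handles \<open>sin\<close>,
  \<open>cos\<close>, \<open>sinh\<close>, \<open>cosh\<close> and \<open>exp\<close> at once.
\<close>

lemma smooth_on_if_second_order_ode:
  fixes f g :: "real \<Rightarrow> real"
  assumes "open U" "\<And>x. x \<in> U \<Longrightarrow> (f has_real_derivative g x) (at x)"
    and "\<And>x. x \<in> U \<Longrightarrow> (g has_real_derivative c * f x) (at x)"
  shows "smooth_on U f"
proof -
  have "Ck_on k U f \<and> Ck_on k U g" for k
  proof (induction k)
    case 0
    then show ?case
      using assms(2,3) by (auto intro!: continuous_at_imp_continuous_on DERIV_isCont)
  next
    case (Suc k)
    then have "Ck_on k U (\<lambda>x. c * f x)"
      by (intro Ck_on_mult[OF assms(1)] Ck_on_const) (rule conjunct1)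
    then have "Ck_on (Suc k) U g"
      by (rule Ck_on_Suc_real[OF assms(1) assms(3), rotated])
    moreover have "Ck_on (Suc k) U f"
      by (rule Ck_on_Suc_real[OF assms(1) assms(2) conjunct2[OF Suc]])
    ultimately show ?case by (rule conjI[rotated])
  qed
  then show ?thesis by (simp add: smooth_on_def)
qed

lemma smooth_on_sin: "smooth_on UNIV (sin :: real \<Rightarrow> real)"
  by (rule smooth_on_if_second_order_ode[where g = cos and c = "-1"]) simp_all

lemma smooth_on_cos: "smooth_on UNIV (cos :: real \<Rightarrow> real)"
  by (rule smooth_on_if_second_order_ode[where g = "\<lambda>x. - sin x" and c = "-1"])
    (simp_all add: DERIV_minus)

lemma smooth_on_sinh: "smooth_on UNIV (sinh :: real \<Rightarrow> real)"
  by (rule smooth_on_if_second_order_ode[where g = cosh and c = 1])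
    (use has_field_derivative_sinh[OF DERIV_ident] has_field_derivative_cosh[OF DERIV_ident] in simp_all)

lemma smooth_on_cosh: "smooth_on UNIV (cosh :: real \<Rightarrow> real)"
  by (rule smooth_on_if_second_order_ode[where g = sinh and c = 1])
    (use has_field_derivative_sinh[OF DERIV_ident] has_field_derivative_cosh[OF DERIV_ident] in simp_all)

lemma smooth_real_has_deriv:
  fixes f :: "real \<Rightarrow> real"
  assumes "smooth_on U f" "x \<in> U"
  shows "(f has_real_derivative deriv f x) (at x)"
proof -
  have "f differentiable (at x)"
    using smooth_on_Ck[OF assms(1), of 1] assms(2) by simp
  then obtain D where "(f has_real_derivative D) (at x)"
    by (rule real_differentiableE)
  then show ?thesis
    by (simp add: DERIV_imp_deriv)
qed

lemma smooth_on_deriv: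
  fixes f :: "real \<Rightarrow> real"
  assumes "open U" "smooth_on U f"
  shows "smooth_on U (deriv f)"
  unfolding smooth_on_def
proof
  fix k
  have "Ck_on k U (\<lambda>x. frechet_derivative f (at x) 1)"
    using smooth_on_Ck[OF assms(2), of "Suc k"] by simp
  moreover have "frechet_derivative f (at x) 1 = deriv f x" if "x \<in> U" for x
    by (simp flip: frechet_derivative_at[OF smooth_real_has_deriv[OF assms(2) that, unfolded has_field_derivative_def]])
  ultimately show "Ck_on k U (deriv f)"
    using Ck_on_cong[OF assms(1), of "\<lambda>x. frechet_derivative f (at x) 1"] by simp
qed

text \<open>
  The derivative of the inverse is \<open>1 / f' \<circ> g\<close>, so if \<open>g\<close> is \<open>k\<close> times continuously differentiable
  then so is its derivative: the formula raises the regularity of \<open>g\<close> step by step.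
\<close>

lemma smooth_on_inverse_function:
  fixes f :: "real \<Rightarrow> real"
  assumes "open U" "smooth_on U f" "\<And>x. x \<in> U \<Longrightarrow> deriv f x \<noteq> 0" "open (f ` U)"
    and inv: "\<And>x. x \<in> U \<Longrightarrow> g (f x) = x"
  shows "smooth_on (f ` U) g"
    and "\<And>x. x \<in> U \<Longrightarrow> (g has_real_derivative inverse (deriv f x)) (at (f x))"
proof -
  have cont: "continuous_on U f"
    using smooth_on_Ck[OF assms(2), of 0] by simp
  show D: "(g has_real_derivative inverse (deriv f x)) (at (f x))" if "x \<in> U" for x
    unfolding has_field_derivative_def
  proof (rule has_derivative_inverse_strong[OF assms(1) that cont inv])
    show "(f has_derivative (*) (deriv f x)) (at x)"
      using smooth_real_has_deriv[OF assms(2) that] by (simp add: has_field_derivative_def)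
  qed (use assms(3)[OF that] in \<open>auto simp: fun_eq_iff\<close>)
  have "Ck_on k (f ` U) g" for k
  proof (induction k)
    case 0
    show ?case
      using DERIV_isCont[OF D] by (auto intro!: continuous_at_imp_continuous_on)
  next
    case (Suc k)
    show ?case
    proof (rule Ck_on_Suc_real[OF assms(4)])
      show "(g has_real_derivative inverse (deriv f (g y))) (at y)" if "y \<in> f ` U" for y
        using that D inv by auto
      have "Ck_on k (f ` U) (\<lambda>y. deriv f (g y))"
        by (rule Ck_on_compose_real[OF assms(4,1) _ smooth_on_Ck[OF smooth_on_deriv[OF assms(1,2)]] Suc])
          (auto simp: inv)
      then show "Ck_on k (f ` U) (\<lambda>y. inverse (deriv f (g y)))"
        by (rule Ck_on_compose_real[OF assms(4) _ _ Ck_on_inverse_real, rotated -1])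
          (auto simp: inv assms(3))
    qed
  qed
  then show "smooth_on (f ` U) g"
    by (simp add: smooth_on_def)
qed

section \<open>The hypersurface of a profile function\<close>

lemma \<eta>_inner: "\<eta> x y = - (fst x * fst y) + snd x \<bullet> snd y"
  by (simp add: \<eta>_def inner_vec_def)

lemma \<Psi>_smooth: "\<alpha> \<in> \<Psi> \<Longrightarrow> smooth_on UNIV \<alpha>"
  and \<Psi>_pos: "\<alpha> \<in> \<Psi> \<Longrightarrow> \<alpha> t > 0"
  and \<Psi>_deriv_h: "\<alpha> \<in> \<Psi> \<Longrightarrow> deriv (h \<alpha>) t \<noteq> 0"
  by (auto simp: \<Psi>_def)

text \<open>
  The companion of \<open>h\<close>: together, \<open>h \<alpha>\<close> and \<open>spatial_radius \<alpha>\<close> parametrize the meridian of the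
  hypersurface of revolution.
\<close>

definition spatial_radius :: "(real \<Rightarrow> real) \<Rightarrow> real \<Rightarrow> real" where
  "spatial_radius \<alpha> t = \<alpha> t * cosh t"

lemma has_derivative_h:
  assumes "smooth_on UNIV \<alpha>"
  shows "(h \<alpha> has_real_derivative deriv \<alpha> t * sinh t + \<alpha> t * cosh t) (at t)"
  unfolding h_def[abs_def]
  by (auto intro!: derivative_eq_intros smooth_real_has_deriv[OF assms])

lemma has_derivative_spatial_radius:
  assumes "smooth_on UNIV \<alpha>"
  shows "(spatial_radius \<alpha> has_real_derivative deriv \<alpha> t * cosh t + \<alpha> t * sinh t) (at t)"
  unfolding spatial_radius_def[abs_def]
  by (auto intro!: derivative_eq_intros smooth_real_has_deriv[OF assms])

lemmas deriv_h = DERIV_imp_deriv[OF has_derivative_h]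
  and deriv_spatial_radius = DERIV_imp_deriv[OF has_derivative_spatial_radius]

lemma smooth_on_h: "smooth_on UNIV \<alpha> \<Longrightarrow> smooth_on UNIV (h \<alpha>)"
  unfolding smooth_on_def h_def[abs_def]
  by (intro allI Ck_on_mult open_UNIV smooth_on_Ck[OF smooth_on_sinh]) simp

lemma smooth_on_spatial_radius: "smooth_on UNIV \<alpha> \<Longrightarrow> smooth_on UNIV (spatial_radius \<alpha>)"
  unfolding smooth_on_def spatial_radius_def[abs_def]
  by (intro allI Ck_on_mult open_UNIV smooth_on_Ck[OF smooth_on_cosh]) simp

lemma inj_h:
  assumes "\<alpha> \<in> \<Psi>"
  shows "inj (h \<alpha>)"
proof (rule linorder_injI)
  fix s t :: real
  assume "s < t"
  note smooth = smooth_on_h[OF \<Psi>_smooth[OF assms]]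
  show "h \<alpha> s \<noteq> h \<alpha> t"
  proof
    assume "h \<alpha> s = h \<alpha> t"
    moreover obtain z where "h \<alpha> t - h \<alpha> s = (t - s) * deriv (h \<alpha>) z"
      using MVT2[OF \<open>s < t\<close>, of "h \<alpha>" "deriv (h \<alpha>)"] smooth_real_has_deriv[OF smooth] by auto
    ultimately show False
      using \<Psi>_deriv_h[OF assms, of z] \<open>s < t\<close> by simp
  qed
qed

lemma open_range_h:
  assumes "\<alpha> \<in> \<Psi>"
  shows "open (range (h \<alpha>))"
  using smooth_on_Ck[OF smooth_on_h[OF \<Psi>_smooth[OF assms]], of 0] inj_h[OF assms]
  by (intro invariance_of_domain) auto

lemma f_of_h: "\<alpha> \<in> \<Psi> \<Longrightarrow> f_of \<alpha> (h \<alpha> t) = \<alpha> t"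
  by (simp add: f_of_def inj_h)

lemma smooth_on_f_of:
  assumes "\<alpha> \<in> \<Psi>"
  shows "smooth_on (range (h \<alpha>)) (f_of \<alpha>)"
    and "(f_of \<alpha> has_real_derivative deriv \<alpha> t / deriv (h \<alpha>) t) (at (h \<alpha> t))"
proof -
  note \<alpha> = \<Psi>_smooth[OF assms]
  note inv = smooth_on_inverse_function[OF open_UNIV smooth_on_h[OF \<alpha>] \<Psi>_deriv_h[OF assms]
      open_range_h[OF assms] inv_f_f[OF inj_h[OF assms]]]
  have "Ck_on k (range (h \<alpha>)) (f_of \<alpha>)" for k
    unfolding f_of_def comp_def
    by (rule Ck_on_compose_real[OF open_range_h[OF assms] open_UNIV subset_UNIV
          smooth_on_Ck[OF \<alpha>] smooth_on_Ck[OF inv(1)]])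
  then show "smooth_on (range (h \<alpha>)) (f_of \<alpha>)"
    by (simp add: smooth_on_def)
  have "(\<alpha> has_real_derivative deriv \<alpha> t) (at (inv_into UNIV (h \<alpha>) (h \<alpha> t)))"
    using smooth_real_has_deriv[OF \<alpha>] inj_h[OF assms] by simp
  from DERIV_chain2[OF this inv(2)[OF UNIV_I]]
  show "(f_of \<alpha> has_real_derivative deriv \<alpha> t / deriv (h \<alpha>) t) (at (h \<alpha> t))"
    by (simp only: f_of_def comp_def divide_inverse)
qed

text \<open>
  At \<open>x\<^sup>0 = h \<alpha> t\<close> the equation reads \<open>\<bar>y\<bar>\<^sup>2 = \<alpha>\<^sup>2 sinh\<^sup>2 + \<alpha>\<^sup>2 = (\<alpha> cosh)\<^sup>2\<close>, and \<open>\<alpha> cosh\<close> is positive.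
\<close>

lemma mem_dS_iff:
  fixes x :: "'m::finite minkowski"
  assumes "\<alpha> \<in> \<Psi>"
  shows "x \<in> dS (range (h \<alpha>)) (f_of \<alpha>) \<longleftrightarrow>
    (\<exists>t. fst x = h \<alpha> t \<and> norm (snd x) = spatial_radius \<alpha> t)"
proof -
  have "- (h \<alpha> t)\<^sup>2 + (\<Sum>i\<in>UNIV. (snd x $ i)\<^sup>2) = (\<alpha> t)\<^sup>2 \<longleftrightarrow> norm (snd x) = spatial_radius \<alpha> t" for t
  proof -
    have "(spatial_radius \<alpha> t)\<^sup>2 = (h \<alpha> t)\<^sup>2 + (\<alpha> t)\<^sup>2"
      by (simp add: spatial_radius_def h_def power_mult_distrib cosh_square_eq algebra_simps)
    moreover have "(\<Sum>i\<in>UNIV. (snd x $ i)\<^sup>2) = (norm (snd x))\<^sup>2"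
      by (simp add: norm_vec_def L2_set_def sum_nonneg)
    moreover have "spatial_radius \<alpha> t \<ge> 0"
      using \<Psi>_pos[OF assms, of t] by (simp add: spatial_radius_def)
    ultimately show ?thesis
      using power2_eq_iff_nonneg[of "norm (snd x)" "spatial_radius \<alpha> t"] by auto
  qed
  then show ?thesis
    by (auto simp: dS_def f_of_h[OF assms])
qed

definition dS_eqn :: "(real \<Rightarrow> real) \<Rightarrow> 'm::finite minkowski \<Rightarrow> real" where
  "dS_eqn \<alpha> x = \<eta> x x - (f_of \<alpha> (fst x))\<^sup>2"

lemma mem_dS_iff_eqn: "x \<in> dS I (f_of \<alpha>) \<longleftrightarrow> fst x \<in> I \<and> dS_eqn \<alpha> x = 0"
  by (auto simp: dS_def dS_eqn_def \<eta>_def power2_eq_square)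

text \<open>
  Up to the factor \<open>spatial_radius \<alpha> t\<close>, this is the vector \<open>(k', h')\<close> in the plane of the meridian,
  which is \<open>\<eta>\<close>-orthogonal to the velocity \<open>(h', k')\<close>. Scaling by that factor avoids normalizing \<open>snd p\<close>.
\<close>

definition dS_normal :: "(real \<Rightarrow> real) \<Rightarrow> real \<Rightarrow> 'm::finite minkowski \<Rightarrow> 'm minkowski" where
  "dS_normal \<alpha> t p =
     (spatial_radius \<alpha> t * deriv (spatial_radius \<alpha>) t, deriv (h \<alpha>) t *\<^sub>R snd p)"

text \<open>
  The gradient of the defining function is proportional to \<open>dS_normal\<close>. Its time component is,
  up to a factor, \<open>h + f f'\<close> with \<open>f' = \<alpha>' / h'\<close>, and \<open>h h' + \<alpha> \<alpha>' = k k'\<close> is half the derivative of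
  \<open>h\<^sup>2 + \<alpha>\<^sup>2 = k\<^sup>2\<close>.
\<close>

lemma has_derivative_dS_eqn:
  fixes p :: "'m::finite minkowski"
  assumes "\<alpha> \<in> \<Psi>" and "fst p = h \<alpha> t"
  shows "(dS_eqn \<alpha> has_derivative (\<lambda>v. 2 / deriv (h \<alpha>) t * \<eta> (dS_normal \<alpha> t p) v)) (at p)"
proof -
  note \<alpha> = \<Psi>_smooth[OF assms(1)]
  have fd: "(f_of \<alpha> has_derivative (\<lambda>s. deriv \<alpha> t / deriv (h \<alpha>) t * s)) (at (fst p))"
    using smooth_on_f_of(2)[OF assms(1), of t]
    unfolding assms(2) has_field_derivative_def .
  have "((\<lambda>x. f_of \<alpha> (fst x)) has_derivative (\<lambda>v. deriv \<alpha> t / deriv (h \<alpha>) t * fst v)) (at p)"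
    by (rule has_derivative_compose[OF has_derivative_fst[OF has_derivative_ident] fd])
  note eq = this[THEN has_derivative_power[where n = 2]]
  have *: "(deriv (h \<alpha>) t) * (h \<alpha> t) + \<alpha> t * deriv \<alpha> t
      = spatial_radius \<alpha> t * deriv (spatial_radius \<alpha>) t"
    unfolding deriv_h[OF \<alpha>] deriv_spatial_radius[OF \<alpha>] h_def spatial_radius_def
    using cosh_square_eq[of t] by algebra
  have H: "deriv (h \<alpha>) t \<noteq> 0"
    by (rule \<Psi>_deriv_h[OF assms(1)])
  show ?thesis
    unfolding dS_eqn_def[abs_def] \<eta>_inner
    by (rule eq derivative_eq_intros refl)+
      (use H in \<open>auto simp: fun_eq_iff dS_normal_def \<eta>_inner assms f_of_h *[symmetric] inner_commute field_simps\<close>)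
qed

lemma open_slab:
  assumes "\<alpha> \<in> \<Psi>"
  shows "open {x :: 'm::finite minkowski. fst x \<in> range (h \<alpha>)}"
  using open_vimage_fst[OF open_range_h[OF assms], where 'b = "real ^ 'm"]
  by (simp add: vimage_def)

lemma smooth_on_dS_eqn:
  assumes "\<alpha> \<in> \<Psi>"
  shows "smooth_on {x :: 'm::finite minkowski. fst x \<in> range (h \<alpha>)} (dS_eqn \<alpha>)"
  unfolding smooth_on_def
proof
  fix k
  let ?U = "{x :: 'm minkowski. fst x \<in> range (h \<alpha>)}"
  have U: "open ?U"
    using open_slab[OF assms] .
  note lin = Ck_on_bounded_linear[OF U bounded_linear_fst, of k]
      Ck_on_bounded_linear[OF U bounded_linear_snd, of k]
  have f: "Ck_on k ?U (\<lambda>x. f_of \<alpha> (fst x))"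
    by (rule Ck_on_compose_real[OF U open_range_h[OF assms] _ smooth_on_Ck[OF smooth_on_f_of(1)[OF assms]] lin(1)])
      auto
  have "Ck_on k ?U (\<lambda>x. (-1) * (fst x * fst x) + snd x \<bullet> snd x + (-1) * (f_of \<alpha> (fst x) * f_of \<alpha> (fst x)))"
    by (intro Ck_on_add[OF U] Ck_on_mult[OF U] Ck_on_inner[OF U] Ck_on_const lin f)
  then show "Ck_on k ?U (dS_eqn \<alpha>)"
    by (simp add: dS_eqn_def[abs_def] \<eta>_inner power2_eq_square)
qed

text \<open>
  The differential is nonzero already on the radial vector \<open>(0, snd x)\<close>. The vector \<open>dS_normal\<close>
  itself would not do as a witness, since it may be null.
\<close>

lemma hypersurface_dS:
  assumes "\<alpha> \<in> \<Psi>"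
  shows "hypersurface (dS (range (h \<alpha>)) (f_of \<alpha>) :: 'm::finite minkowski set)"
  unfolding hypersurface_def
proof (intro ballI exI conjI)
  let ?S = "dS (range (h \<alpha>)) (f_of \<alpha>) :: 'm minkowski set"
  let ?U = "{x :: 'm minkowski. fst x \<in> range (h \<alpha>)}"
  show "open ?U"
    using open_slab[OF assms] .
  show "smooth_on ?U (dS_eqn \<alpha>)"
    by (rule smooth_on_dS_eqn[OF assms])
  show "?S \<inter> ?U = {x \<in> ?U. dS_eqn \<alpha> x = 0}"
    by (auto simp: mem_dS_iff_eqn)
  show "p \<in> ?U" if "p \<in> ?S" for p
    using that by (simp add: mem_dS_iff_eqn)
  show "frechet_derivative (dS_eqn \<alpha>) (at x) (0, snd x) \<noteq> 0" if x: "x \<in> ?S \<inter> ?U" for x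
  proof -
    obtain t where t: "fst x = h \<alpha> t" "norm (snd x) = spatial_radius \<alpha> t"
      using x mem_dS_iff[OF assms, of x] by blast
    have "snd x \<noteq> 0"
      using t(2) \<Psi>_pos[OF assms, of t] by (auto simp: spatial_radius_def)
    then show ?thesis
      using \<Psi>_deriv_h[OF assms]
      by (simp add: frechet_derivative_at[OF has_derivative_dS_eqn[OF assms t(1)], symmetric]
          dS_normal_def \<eta>_inner)
  qed
qed

lemma tangent_spaceI:
  assumes "smooth_on UNIV \<gamma>" "range \<gamma> \<subseteq> S" "\<gamma> 0 = p" "(\<gamma> has_vector_derivative v) (at 0)"
  shows "v \<in> tangent_space S p"
proof -
  have "Ck_on k U f" if "Ck_on k UNIV f" for k U and f :: "real \<Rightarrow> 'a"
    using that by (induction k arbitrary: f) (auto intro: continuous_on_subset)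
  then have "smooth_on {-1<..<1} \<gamma>"
    using assms(1) by (simp add: smooth_on_def)
  then show ?thesis
    using assms(2-4) unfolding tangent_space_def by (intro CollectI exI[of _ \<gamma>] exI[of _ 1]) auto
qed

text \<open>
  The velocity of the curve \<open>s \<mapsto> (h (t + s), k (t + s) w)\<close>, where \<open>w\<close> is the direction of \<open>snd p\<close>.
\<close>

lemma meridian_tangent:
  fixes p :: "'m::finite minkowski"
  assumes "\<alpha> \<in> \<Psi>" "fst p = h \<alpha> t" "norm (snd p) = spatial_radius \<alpha> t"
  shows "(deriv (h \<alpha>) t, (deriv (spatial_radius \<alpha>) t / spatial_radius \<alpha> t) *\<^sub>R snd p)
    \<in> tangent_space (dS (range (h \<alpha>)) (f_of \<alpha>)) p"
proof -
  note \<alpha> = \<Psi>_smooth[OF assms(1)]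
  have pos: "spatial_radius \<alpha> s > 0" for s
    using \<Psi>_pos[OF assms(1), of s] by (simp add: spatial_radius_def)
  define w where "w = inverse (spatial_radius \<alpha> t) *\<^sub>R snd p"
  define \<gamma> :: "real \<Rightarrow> 'm minkowski" where
    "\<gamma> s = h \<alpha> (t + s) *\<^sub>R (1, 0) + spatial_radius \<alpha> (t + s) *\<^sub>R (0, w)" for s
  have "norm w = 1"
    using pos[of t] by (simp add: w_def assms(3))
  have shift_Ck: "Ck_on k UNIV (\<lambda>s. \<phi> (t + s))" if "smooth_on UNIV \<phi>" for k and \<phi> :: "real \<Rightarrow> real"
    using Ck_on_bounded_linear[OF open_UNIV bounded_linear_ident]
    by (intro Ck_on_compose_real[OF _ _ _ smooth_on_Ck[OF that]] Ck_on_add Ck_on_const) auto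
  have "Ck_on k UNIV \<gamma>" for k
    unfolding \<gamma>_def[abs_def]
    by (intro Ck_on_add Ck_on_scaleR Ck_on_const open_UNIV
        shift_Ck[OF smooth_on_h[OF \<alpha>]] shift_Ck[OF smooth_on_spatial_radius[OF \<alpha>]])
  then have smooth: "smooth_on UNIV \<gamma>"
    by (simp add: smooth_on_def)
  have D: "(\<gamma> has_vector_derivative
     deriv (h \<alpha>) t *\<^sub>R (1, 0) + deriv (spatial_radius \<alpha>) t *\<^sub>R (0, w)) (at 0)"
  proof -
    have "((\<lambda>s. \<phi> (t + s) *\<^sub>R v) has_vector_derivative deriv \<phi> t *\<^sub>R v) (at 0)"
      if "smooth_on UNIV \<phi>" for \<phi> :: "real \<Rightarrow> real" and v :: "'m minkowski"
    proof -
      have "((\<lambda>s. \<phi> (t + s)) has_real_derivative deriv \<phi> t) (at 0)"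
        using DERIV_shift[of \<phi> "deriv \<phi> t" 0 t] smooth_real_has_deriv[OF that, of t]
        by (simp add: add.commute)
      from has_vector_derivative_scaleR[OF this has_vector_derivative_const[of v]] show ?thesis
        by simp
    qed
    from has_vector_derivative_add[OF this[OF smooth_on_h[OF \<alpha>]] this[OF smooth_on_spatial_radius[OF \<alpha>]]]
    show ?thesis
      unfolding \<gamma>_def[abs_def] .
  qed
  have "range \<gamma> \<subseteq> dS (range (h \<alpha>)) (f_of \<alpha>)"
    using pos by (auto simp: mem_dS_iff[OF assms(1)] \<gamma>_def \<open>norm w = 1\<close> less_imp_le intro!: exI)
  moreover have "\<gamma> 0 = p"
    using pos[of t] by (simp add: \<gamma>_def w_def assms(2)[symmetric])
  ultimately show ?thesis
    using tangent_spaceI[OF smooth _ _ D] by (simp add: w_def divide_inverse)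
qed

text \<open>
  The velocity of a rotation of \<open>snd p\<close> in the plane that it spans with \<open>\<xi>\<close>.
\<close>

lemma rotation_tangent:
  fixes p :: "'m::finite minkowski"
  assumes "\<alpha> \<in> \<Psi>" "p \<in> dS (range (h \<alpha>)) (f_of \<alpha>)"
    and "\<xi> \<bullet> snd p = 0" "norm \<xi> = norm (snd p)"
  shows "(0, \<xi>) \<in> tangent_space (dS (range (h \<alpha>)) (f_of \<alpha>)) p"
proof -
  define \<gamma> :: "real \<Rightarrow> 'm minkowski" where
    "\<gamma> s = (fst p, 0) + (cos s *\<^sub>R (0, snd p) + sin s *\<^sub>R (0, \<xi>))" for s
  have "Ck_on k UNIV \<gamma>" for k
    unfolding \<gamma>_def[abs_def]
    by (intro Ck_on_add Ck_on_scaleR Ck_on_const open_UNIV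
        smooth_on_Ck[OF smooth_on_sin] smooth_on_Ck[OF smooth_on_cos])
  then have smooth: "smooth_on UNIV \<gamma>"
    by (simp add: smooth_on_def)
  have D: "(\<gamma> has_vector_derivative (0, \<xi>)) (at 0)"
    unfolding \<gamma>_def[abs_def] by (auto intro!: derivative_eq_intros)
  have "norm (cos s *\<^sub>R snd p + sin s *\<^sub>R \<xi>) = norm (snd p)" for s
  proof (rule power2_eq_imp_eq)
    have "snd p \<bullet> \<xi> = 0"
      using assms(3) by (simp add: inner_commute)
    then have "(norm (cos s *\<^sub>R snd p + sin s *\<^sub>R \<xi>))\<^sup>2
        = (cos s)\<^sup>2 * (norm (snd p))\<^sup>2 + (sin s)\<^sup>2 * (norm \<xi>)\<^sup>2"
      using assms(3)
      by (simp add: power2_norm_eq_inner inner_add_left inner_add_right)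
        (simp add: power2_eq_square)
    also have "\<dots> = (norm (snd p))\<^sup>2"
      using assms(4) by (simp add: distrib_right[symmetric])
    finally show "(norm (cos s *\<^sub>R snd p + sin s *\<^sub>R \<xi>))\<^sup>2 = (norm (snd p))\<^sup>2" .
  qed auto
  then have "range \<gamma> \<subseteq> dS (range (h \<alpha>)) (f_of \<alpha>)"
    using assms(2) by (auto simp: mem_dS_iff[OF assms(1)] \<gamma>_def)
  moreover have "\<gamma> 0 = p"
    by (simp add: \<gamma>_def)
  ultimately show ?thesis
    using tangent_spaceI[OF smooth _ _ D] by blast
qed

text \<open>
  Multiples of \<open>dS_normal\<close> are normal because the defining function vanishes along every curve in
  the hypersurface. Conversely, orthogonality to the rotations forces the spatial part of a normal
  vector to be a multiple of \<open>snd p\<close>, and orthogonality to the meridian then fixes its time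
  component.
\<close>

lemma normal_space_dS:
  fixes p :: "'m::finite minkowski"
  assumes "\<alpha> \<in> \<Psi>" and t: "fst p = h \<alpha> t" "norm (snd p) = spatial_radius \<alpha> t"
  shows "normal_space (dS (range (h \<alpha>)) (f_of \<alpha>)) p = range (\<lambda>c. c *\<^sub>R dS_normal \<alpha> t p)"
proof (intro equalityI subsetI)
  let ?S = "dS (range (h \<alpha>)) (f_of \<alpha>) :: 'm minkowski set"
  let ?H = "deriv (h \<alpha>) t" and ?k = "spatial_radius \<alpha> t" and ?K = "deriv (spatial_radius \<alpha>) t"
  have p: "p \<in> ?S"
    using t mem_dS_iff[OF assms(1)] by blast
  have H: "?H \<noteq> 0"
    by (rule \<Psi>_deriv_h[OF assms(1)])
  have k: "?k > 0"
    using \<Psi>_pos[OF assms(1), of t] by (simp add: spatial_radius_def)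
  {
    fix v
    assume "v \<in> range (\<lambda>c. c *\<^sub>R dS_normal \<alpha> t p)"
    then obtain c where c: "v = c *\<^sub>R dS_normal \<alpha> t p" by blast
    have "\<eta> (dS_normal \<alpha> t p) w = 0" if w: "w \<in> tangent_space ?S p" for w
    proof -
      from w obtain \<gamma> e where \<gamma>: "e > 0" "\<gamma> ` {-e<..<e} \<subseteq> ?S" "\<gamma> 0 = p"
        "(\<gamma> has_vector_derivative w) (at 0)"
        unfolding tangent_space_def by blast
      have zero: "dS_eqn \<alpha> (\<gamma> s) = 0" if "s \<in> {-e<..<e}" for s
        using \<gamma>(2) that mem_dS_iff_eqn[of "\<gamma> s"] by blast
      have "((\<lambda>s. dS_eqn \<alpha> (\<gamma> s)) has_derivative (\<lambda>s. 0)) (at 0)"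
        by (rule has_derivative_transform_within_open[OF has_derivative_const[of 0], of "{-e<..<e}"])
          (use \<gamma>(1) zero in auto)
      moreover have "((\<lambda>s. dS_eqn \<alpha> (\<gamma> s)) has_derivative
          (\<lambda>s. 2 / ?H * \<eta> (dS_normal \<alpha> t p) (s *\<^sub>R w))) (at 0)"
        using has_derivative_compose[OF \<gamma>(4)[unfolded has_vector_derivative_def]]
          has_derivative_dS_eqn[OF assms(1) t(1)] \<gamma>(3) by blast
      ultimately have "(\<lambda>s. 0) = (\<lambda>s. 2 / ?H * \<eta> (dS_normal \<alpha> t p) (s *\<^sub>R w))"
        by (rule has_derivative_unique)
      from fun_cong[OF this, of 1] show ?thesis
        using H by simp
    qed
    then show "v \<in> normal_space ?S p"
      by (auto simp: normal_space_def c \<eta>_inner algebra_simps)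
  }
  {
    fix v
    assume "v \<in> normal_space ?S p"
    then have normal: "\<eta> v w = 0" if "w \<in> tangent_space ?S p" for w
      using that by (simp add: normal_space_def)
    \<comment> \<open>\<open>\<xi>\<close> is the component of the spatial part of \<open>v\<close> orthogonal to \<open>snd p\<close>; it must vanish.\<close>
    define a where "a = (snd v \<bullet> snd p) / ?k\<^sup>2"
    define \<xi> where "\<xi> = snd v - a *\<^sub>R snd p"
    have "snd p \<bullet> snd p = ?k\<^sup>2"
      by (simp add: power2_norm_eq_inner[symmetric] t(2))
    then have orth: "\<xi> \<bullet> snd p = 0"
      using k by (simp add: \<xi>_def a_def inner_diff_left)
    have "\<xi> = 0"
    proof (rule ccontr)
      assume "\<xi> \<noteq> 0"
      \<comment> \<open>Rescaled to the length of \<open>snd p\<close>, the vector \<open>\<xi>\<close> is the velocity of a rotation.\<close>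
      then have "(0, (?k / norm \<xi>) *\<^sub>R \<xi>) \<in> tangent_space ?S p"
        using orth k t(2) by (intro rotation_tangent assms(1) p) auto
      from normal[OF this] have "snd v \<bullet> \<xi> = 0"
        using k \<open>\<xi> \<noteq> 0\<close> by (simp add: \<eta>_inner)
      moreover have "snd v = \<xi> + a *\<^sub>R snd p"
        by (simp add: \<xi>_def)
      ultimately show False
        using orth \<open>\<xi> \<noteq> 0\<close> by (simp add: inner_add_left inner_add_right inner_commute)
    qed
    then have v: "snd v = a *\<^sub>R snd p"
      by (simp add: \<xi>_def)
    have "fst v * ?H = a * ?k * ?K"
      using normal[OF meridian_tangent[OF assms(1) t]] k \<open>snd p \<bullet> snd p = ?k\<^sup>2\<close>
      by (simp add: \<eta>_inner v power2_eq_square mult_ac)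
    then have "v = (a / ?H) *\<^sub>R dS_normal \<alpha> t p"
      using H by (simp add: prod_eq_iff dS_normal_def v field_simps)
    then show "v \<in> range (\<lambda>c. c *\<^sub>R dS_normal \<alpha> t p)"
      by blast
  }
qed

lemma \<eta>_dS_normal:
  fixes p :: "'m::finite minkowski"
  assumes "\<alpha> \<in> \<Psi>" "norm (snd p) = spatial_radius \<alpha> t"
  shows "\<eta> (dS_normal \<alpha> t p) (dS_normal \<alpha> t p)
    = (spatial_radius \<alpha> t)\<^sup>2 * ((\<alpha> t)\<^sup>2 - (deriv \<alpha> t)\<^sup>2)"
proof -
  have "snd p \<bullet> snd p = (spatial_radius \<alpha> t)\<^sup>2"
    by (simp add: power2_norm_eq_inner[symmetric] assms(2))
  then have "\<eta> (dS_normal \<alpha> t p) (dS_normal \<alpha> t p)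
    = (spatial_radius \<alpha> t)\<^sup>2 * ((deriv (h \<alpha>) t)\<^sup>2 - (deriv (spatial_radius \<alpha>) t)\<^sup>2)"
    by (simp add: \<eta>_inner dS_normal_def power2_eq_square algebra_simps)
  also have "(deriv (h \<alpha>) t)\<^sup>2 - (deriv (spatial_radius \<alpha>) t)\<^sup>2 = (\<alpha> t)\<^sup>2 - (deriv \<alpha> t)\<^sup>2"
    unfolding deriv_h[OF \<Psi>_smooth[OF assms(1)]] deriv_spatial_radius[OF \<Psi>_smooth[OF assms(1)]]
    using cosh_square_eq[of t] by algebra
  finally show ?thesis .
qed

text \<open>
  The causal character of a vector depends on the sign of \<open>\<eta> v v\<close> only, which for the normals at
  the parameter \<open>t\<close> is the sign of \<open>\<alpha>\<^sup>2 - \<alpha>'\<^sup>2\<close>. The predicate \<open>Q\<close>, invariant under positive scaling,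
  stands for a condition on the sign, so that one proof covers the timelike and the null case.
\<close>

lemma dS_normals_iff:
  fixes P :: "'m::finite minkowski \<Rightarrow> bool"
  assumes "\<alpha> \<in> \<Psi>"
    and "\<And>v. v \<noteq> 0 \<Longrightarrow> P v \<longleftrightarrow> Q (\<eta> v v)"
    and "\<And>c s. c > 0 \<Longrightarrow> Q (c * s) \<longleftrightarrow> Q s"
  shows "(\<forall>p\<in>dS (range (h \<alpha>)) (f_of \<alpha>). \<forall>v\<in>normal_space (dS (range (h \<alpha>)) (f_of \<alpha>)) p. v \<noteq> 0 \<longrightarrow> P v)
    \<longleftrightarrow> (\<forall>t. Q ((\<alpha> t)\<^sup>2 - (deriv \<alpha> t)\<^sup>2))" (is "?L \<longleftrightarrow> ?R")
proof -
  let ?S = "dS (range (h \<alpha>)) (f_of \<alpha>) :: 'm minkowski set"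
  have k: "spatial_radius \<alpha> t > 0" for t
    using \<Psi>_pos[OF assms(1), of t] by (simp add: spatial_radius_def)
  have key: "(\<forall>v\<in>normal_space ?S p. v \<noteq> 0 \<longrightarrow> P v) \<longleftrightarrow> Q ((\<alpha> t)\<^sup>2 - (deriv \<alpha> t)\<^sup>2)"
    if t: "fst p = h \<alpha> t" "norm (snd p) = spatial_radius \<alpha> t" for p t
  proof -
    let ?N = "dS_normal \<alpha> t p"
    have "snd p \<noteq> 0"
      using t(2) k[of t] by auto
    then have "?N \<noteq> 0"
      using \<Psi>_deriv_h[OF assms(1), of t] by (simp add: dS_normal_def prod_eq_iff)
    have "P (c *\<^sub>R ?N) \<longleftrightarrow> Q ((\<alpha> t)\<^sup>2 - (deriv \<alpha> t)\<^sup>2)" if "c \<noteq> 0" for c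
    proof -
      have "\<eta> (c *\<^sub>R ?N) (c *\<^sub>R ?N) = c\<^sup>2 * \<eta> ?N ?N"
        by (simp add: \<eta>_inner power2_eq_square algebra_simps)
      also have "\<dots> = (c\<^sup>2 * (spatial_radius \<alpha> t)\<^sup>2) * ((\<alpha> t)\<^sup>2 - (deriv \<alpha> t)\<^sup>2)"
        by (simp add: \<eta>_dS_normal[OF assms(1) t(2)])
      finally show ?thesis
        using assms(2)[of "c *\<^sub>R ?N"] assms(3)[of "c\<^sup>2 * (spatial_radius \<alpha> t)\<^sup>2"] that \<open>?N \<noteq> 0\<close> k[of t]
        by simp
    qed
    from this this[of 1] show ?thesis
      unfolding normal_space_dS[OF assms(1) t] using \<open>?N \<noteq> 0\<close> by fastforce
  qed
  \<comment> \<open>Every parameter occurs at some point, so conditions on all points constrain all \<open>t\<close>.\<close>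
  have "\<exists>p\<in>?S. fst p = h \<alpha> t \<and> norm (snd p) = spatial_radius \<alpha> t" for t
  proof -
    obtain y :: "real ^ 'm" where "norm y = spatial_radius \<alpha> t"
      using vector_choose_size[of "spatial_radius \<alpha> t"] k[of t] by (auto simp: less_imp_le)
    then show ?thesis
      using mem_dS_iff[OF assms(1), of "(h \<alpha> t, y)"] by (intro bexI[of _ "(h \<alpha> t, y)"]) auto
  qed
  then show ?thesis
    using key mem_dS_iff[OF assms(1)] by metis
qed

lemma timelike_dS_iff:
  assumes "\<alpha> \<in> \<Psi>"
  shows "timelike_hypersurface (dS (range (h \<alpha>)) (f_of \<alpha>) :: 'm::finite minkowski set)
    \<longleftrightarrow> (\<forall>t. (deriv \<alpha> t)\<^sup>2 < (\<alpha> t)\<^sup>2)"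
  using dS_normals_iff[OF assms, of "spacelike :: 'm minkowski \<Rightarrow> bool" "\<lambda>s. s > 0"]
    hypersurface_dS[OF assms, where 'm = 'm]
  by (simp add: timelike_hypersurface_def spacelike_def zero_less_mult_iff)

lemma null_dS_iff:
  assumes "\<alpha> \<in> \<Psi>"
  shows "null_hypersurface (dS (range (h \<alpha>)) (f_of \<alpha>) :: 'm::finite minkowski set)
    \<longleftrightarrow> (\<forall>t. (deriv \<alpha> t)\<^sup>2 = (\<alpha> t)\<^sup>2)"
  using dS_normals_iff[OF assms, of "null :: 'm minkowski \<Rightarrow> bool" "\<lambda>s. s = 0"]
    hypersurface_dS[OF assms, where 'm = 'm]
  by (auto simp: null_hypersurface_def null_def)

section \<open>Exponential profiles\<close>

lemma deriv_exp_profile: "deriv (\<lambda>t. r * exp (lam * t)) t = lam * (r * exp (lam * t))"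
  for r lam t :: real
  by (rule DERIV_imp_deriv) (auto intro!: derivative_eq_intros)

lemma smooth_on_exp_profile: "smooth_on UNIV (\<lambda>t. r * exp (lam * t))"
  for r lam :: real
  by (rule smooth_on_if_second_order_ode[where g = "\<lambda>t. lam * (r * exp (lam * t))" and c = "lam\<^sup>2"])
    (auto intro!: derivative_eq_intros simp: power2_eq_square)

text \<open>
  Up to the positive factor \<open>exp (- t) / 2\<close> the function is \<open>(1 + \<lambda>) exp (2 t) + (1 - \<lambda>)\<close>. For
  \<open>\<bar>\<lambda>\<bar> \<le> 1\<close> this is a sum of nonnegative terms that do not both vanish; otherwise it vanishes at
  \<open>exp (2 t) = (\<lambda> - 1) / (\<lambda> + 1) > 0\<close>.
\<close>

lemma cosh_plus_sinh_nonzero_iff: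
  fixes lam :: real
  shows "(\<forall>t. lam * sinh t + cosh t \<noteq> 0) \<longleftrightarrow> -1 \<le> lam \<and> lam \<le> 1"
proof -
  have eq: "lam * sinh t + cosh t = exp (- t) * ((1 + lam) * exp (2 * t) + (1 - lam)) / 2" for t
  proof -
    have "exp (2 * t) = exp t * exp t"
      by (simp flip: exp_add)
    then show ?thesis
      by (simp add: sinh_field_def cosh_field_def exp_minus field_simps)
  qed
  have "lam * sinh t + cosh t > 0" if "-1 \<le> lam" "lam \<le> 1" for t
  proof -
    have "(1 + lam) * exp (2 * t) \<ge> 0" "1 - lam \<ge> 0" "(1 + lam) * exp (2 * t) \<noteq> 0 \<or> 1 - lam \<noteq> 0"
      using that by auto
    then have "(1 + lam) * exp (2 * t) + (1 - lam) > 0"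
      by linarith
    then show ?thesis
      by (simp add: eq)
  qed
  moreover have "\<exists>t. lam * sinh t + cosh t = 0" if "\<not> (-1 \<le> lam \<and> lam \<le> 1)"
  proof
    have "(lam - 1) / (lam + 1) > 0"
      using that by (auto simp: zero_less_divide_iff)
    then have "exp (2 * (ln ((lam - 1) / (lam + 1)) / 2)) = (lam - 1) / (lam + 1)"
      by simp
    then show "lam * sinh (ln ((lam - 1) / (lam + 1)) / 2) + cosh (ln ((lam - 1) / (lam + 1)) / 2) = 0"
      unfolding eq using that by (auto simp: field_simps)
  qed
  ultimately show ?thesis
    by (metis less_irrefl)
qed

lemma exp_profile_in_\<Psi>_iff:
  fixes r lam :: real
  assumes "r > 0"
  shows "(\<lambda>t. r * exp (lam * t)) \<in> \<Psi> \<longleftrightarrow> -1 \<le> lam \<and> lam \<le> 1"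
proof -
  have "deriv (h (\<lambda>t. r * exp (lam * t))) t = r * exp (lam * t) * (lam * sinh t + cosh t)" for t
    unfolding deriv_h[OF smooth_on_exp_profile] deriv_exp_profile by (simp add: algebra_simps)
  then show ?thesis
    using assms by (simp add: \<Psi>_def smooth_on_exp_profile cosh_plus_sinh_nonzero_iff)
qed

theorem corollary3p9:
  fixes n :: nat and r lam :: real and \<alpha> :: "real \<Rightarrow> real"
  assumes "n \<ge> 1" and "CARD('m::finite) = n + 1"
    and "r > 0" and "\<alpha> = (\<lambda>t. r * exp (lam * t))"
  shows "(\<alpha> \<in> \<Psi> \<longleftrightarrow> - 1 \<le> lam \<and> lam \<le> 1) \<and>
    (\<alpha> \<in> \<Psi> \<and> timelike_hypersurface (dS (range (h \<alpha>)) (f_of \<alpha>) :: 'm minkowski set)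
       \<longleftrightarrow> - 1 < lam \<and> lam < 1) \<and>
    (\<alpha> \<in> \<Psi> \<and> null_hypersurface (dS (range (h \<alpha>)) (f_of \<alpha>) :: 'm minkowski set)
       \<longleftrightarrow> lam = 1 \<or> lam = - 1)"
proof -
  have mem: "\<alpha> \<in> \<Psi> \<longleftrightarrow> - 1 \<le> lam \<and> lam \<le> 1"
    using exp_profile_in_\<Psi>_iff[OF assms(3)] assms(4) by simp
  have deriv: "(deriv \<alpha> t)\<^sup>2 = lam\<^sup>2 * (\<alpha> t)\<^sup>2" and pos: "(\<alpha> t)\<^sup>2 > 0" for t
    using assms(3) by (simp_all add: assms(4) deriv_exp_profile power_mult_distrib)
  have "(\<forall>t. (deriv \<alpha> t)\<^sup>2 < (\<alpha> t)\<^sup>2) \<longleftrightarrow> lam\<^sup>2 < 1"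
    unfolding deriv using pos by simp
  moreover have "(\<forall>t. (deriv \<alpha> t)\<^sup>2 = (\<alpha> t)\<^sup>2) \<longleftrightarrow> lam\<^sup>2 = 1"
    unfolding deriv using pos by (simp add: less_le)
  ultimately show ?thesis
    using mem timelike_dS_iff[of \<alpha>, where 'm = 'm] null_dS_iff[of \<alpha>, where 'm = 'm]
    by (auto simp: power2_eq_1_iff abs_square_less_1 abs_less_iff)
qed

end
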